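(* Let $\psi:\Sigma^2\to\mathbb H^3$ be a complete vertical graph in the $3$-dimensional hyperbolic space $\mathbb H^3=\mathbb R\times_{e^t}\mathbb R^2$, with nonnegative Gaussian curvature $K_\Sigma$ and constant mean curvature $\frac{\sqrt2}{2}\le H\le1$. Let $h$ be its height function. If $$|\nabla h|^2\le 1-H^2$$ on $\Sigma$, then $\psi(\Sigma)$ is a horosphere of $\mathbb H^3$.
   Context: $\mathbb H^{3}=\mathbb R\times_{e^t}\mathbb R^2$ is the manifold $\mathbb R\times\mathbb R^2$ with the Riemannian metric $\langle\,,\rangle=dt^2+e^{2t}\langle\,,\rangle_{\mathbb R^2}$, where $\langle\,,\rangle_{\mathbb R^2}$ is the Euclidean metric; it is isometric to hyperbolic space of constant curvature $-1$. $\partial_t$ is the coordinate vector field of the first factor. The fibers $\{t_0\}\times\mathbb R^2$ are horospheres. A vertical graph is an immersion of the form $\psi(x)=(u(x),x)$ for a smooth function $u:\mathbb R^2\to[0,+\infty)$, so that $\Sigma$ is identified with $\mathbb R^2$ (the fiber $\{0\}\times\mathbb R^2$) endowed with the metric induced by $\psi$. Completeness, $K_\Sigma$, the gradient $\nabla$ and its norm refer to this induced metric. The height function $h:\Sigma\to\mathbb R$ is the restriction to $\Sigma$ of the projection onto the first factor; thus $h=u\ge0$. $\Sigma$ is oriented by the unit normal $N$ with $\langle N,V\rangle<0$, where $V=e^t\partial_t$, equivalently $\langle N,\partial_t\rangle<0$. With $\overline\nabla$ the Levi-Civita connection of $\mathbb H^{3}$, the shape operator is $AX=-\overline\nabla_XN$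 and the mean curvature is $H=\mathrm{tr}(A)/2$ (so the fibers, oriented by $-\partial_t$, have $H=1$). *)

theory Defs
  imports "HOL-Analysis.Analysis"
begin

section \<open>Riemannian geometry in a global chart\<close>

text \<open>
  Every manifold below is a Euclidean space \<^typ>\<open>'a\<close> in a single global chart.  Its tangent spaces
  are identified with \<^typ>\<open>'a\<close>, and a Riemannian metric assigns to each point \<open>p\<close> an inner product
  \<open>g p\<close>.
\<close>

type_synonym 'a riem = "'a \<Rightarrow> 'a \<Rightarrow> 'a \<Rightarrow> real"

primrec C_k :: "nat \<Rightarrow> ('a::real_normed_vector \<Rightarrow> 'b::real_normed_vector) \<Rightarrow> bool" where
  "C_k 0 f \<longleftrightarrow> continuous_on UNIV f"
| "C_k (Suc k) f \<longleftrightarrow>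
     (\<forall>x. f differentiable (at x)) \<and> (\<forall>v. C_k k (\<lambda>x. frechet_derivative f (at x) v))"

definition smooth :: "('a::real_normed_vector \<Rightarrow> 'b::real_normed_vector) \<Rightarrow> bool" where
  "smooth f \<longleftrightarrow> (\<forall>k. C_k k f)"

definition pullback_metric ::
    "'b::real_normed_vector riem \<Rightarrow> ('a::real_normed_vector \<Rightarrow> 'b) \<Rightarrow> 'a riem" where
  "pullback_metric g \<psi> x v w =
     g (\<psi> x) (frechet_derivative \<psi> (at x) v) (frechet_derivative \<psi> (at x) w)"

text \<open>
  Only curves of finite length contribute to the distance: \<open>has_integral\<close> cannot be replaced by
  \<open>integral\<close>, which is 0 for a non-integrable speed.
\<close>

definition has_riem_length :: "'a::real_normed_vector riem \<Rightarrow> (real \<Rightarrow> 'a) \<Rightarrow> real \<Rightarrow> bool" where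
  "has_riem_length g \<gamma> L \<longleftrightarrow> valid_path \<gamma> \<and>
     ((\<lambda>s. sqrt (g (\<gamma> s) (vector_derivative \<gamma> (at s)) (vector_derivative \<gamma> (at s)))) has_integral L)
       {0..1}"

definition riem_dist :: "'a::real_normed_vector riem \<Rightarrow> 'a \<Rightarrow> 'a \<Rightarrow> real" where
  "riem_dist g p q =
     Inf {L. \<exists>\<gamma>. pathstart \<gamma> = p \<and> pathfinish \<gamma> = q \<and> has_riem_length g \<gamma> L}"

definition riem_complete :: "'a::real_normed_vector riem \<Rightarrow> bool" where
  "riem_complete g \<longleftrightarrow> Metric_space.mcomplete UNIV (riem_dist g)"

definition riem_gradient ::
    "'a::real_normed_vector riem \<Rightarrow> ('a \<Rightarrow> real) \<Rightarrow> 'a \<Rightarrow> 'a" where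
  "riem_gradient g f x = (THE z. \<forall>v. g x z v = frechet_derivative f (at x) v)"

text \<open>
  \<open>christoffel g p v w\<close> is the value at \<open>p\<close> of the Levi-Civita derivative \<open>\<nabla>\<^sub>v w\<close> of constant
  fields \<open>v\<close> and \<open>w\<close>, that is \<open>\<Gamma>\<^sup>k\<^sub>i\<^sub>j v\<^sup>i w\<^sup>j\<close>; the defining equation is the Koszul formula, in
  which the brackets of constant fields vanish.
\<close>

definition christoffel :: "'a::real_normed_vector riem \<Rightarrow> 'a \<Rightarrow> 'a \<Rightarrow> 'a \<Rightarrow> 'a" where
  "christoffel g p v w = (THE z. \<forall>y.
     2 * g p z y =
       frechet_derivative (\<lambda>q. g q w y) (at p) v
       + frechet_derivative (\<lambda>q. g q v y) (at p) w
       - frechet_derivative (\<lambda>q. g q v w) (at p) y)"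

text \<open>
  Levi-Civita derivative in direction \<open>v\<close> of a vector field \<open>W\<close> along the map \<open>\<psi>\<close>.
\<close>

definition cov_deriv_along ::
    "'b::real_normed_vector riem \<Rightarrow> ('a::real_normed_vector \<Rightarrow> 'b) \<Rightarrow> ('a \<Rightarrow> 'b) \<Rightarrow> 'a \<Rightarrow> 'a \<Rightarrow> 'b" where
  "cov_deriv_along g \<psi> W x v =
     frechet_derivative W (at x) v
     + christoffel g (\<psi> x) (frechet_derivative \<psi> (at x) v) (W x)"

text \<open>
  \<open>R(v,w)y = \<nabla>\<^sub>v\<nabla>\<^sub>w y - \<nabla>\<^sub>w\<nabla>\<^sub>v y\<close> for constant fields.
\<close>

definition riem_curvature :: "'a::real_normed_vector riem \<Rightarrow> 'a \<Rightarrow> 'a \<Rightarrow> 'a \<Rightarrow> 'a \<Rightarrow> 'a" where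
  "riem_curvature g p v w y =
     cov_deriv_along g (\<lambda>q. q) (\<lambda>q. christoffel g q w y) p v
     - cov_deriv_along g (\<lambda>q. q) (\<lambda>q. christoffel g q v y) p w"

definition gaussian_curvature :: "(real^2) riem \<Rightarrow> real^2 \<Rightarrow> real" where
  "gaussian_curvature g p =
     (let e1 = axis 1 1; e2 = axis 2 1 in
        g p (riem_curvature g p e1 e2 e2) e1 / (g p e1 e1 * g p e2 e2 - (g p e1 e2)\<^sup>2))"

section \<open>Oriented surfaces\<close>

definition unit_normal_field ::
    "'b::real_normed_vector riem \<Rightarrow> (real^2 \<Rightarrow> 'b) \<Rightarrow> (real^2 \<Rightarrow> 'b) \<Rightarrow> bool" where
  "unit_normal_field g \<psi> N \<longleftrightarrow>
     (\<forall>x. g (\<psi> x) (N x) (N x) = 1 \<and>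
          (\<forall>v. g (\<psi> x) (N x) (frechet_derivative \<psi> (at x) v) = 0))"

text \<open>
  The shape operator acts on the tangent space of the parameter domain: it sends \<open>v\<close> to the \<open>w\<close>
  with \<open>d\<psi>(w) = - \<nabla>\<^sub>v N\<close>.
\<close>

definition shape_operator ::
    "'b::real_normed_vector riem \<Rightarrow> (real^2 \<Rightarrow> 'b) \<Rightarrow> (real^2 \<Rightarrow> 'b) \<Rightarrow> real^2 \<Rightarrow> real^2 \<Rightarrow> real^2" where
  "shape_operator g \<psi> N x v =
     (THE w. frechet_derivative \<psi> (at x) w = - cov_deriv_along g \<psi> N x v)"

definition mean_curvature ::
    "'b::real_normed_vector riem \<Rightarrow> (real^2 \<Rightarrow> 'b) \<Rightarrow> (real^2 \<Rightarrow> 'b) \<Rightarrow> real^2 \<Rightarrow> real" where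
  "mean_curvature g \<psi> N x = trace (matrix (shape_operator g \<psi> N x)) / 2"

section \<open>Hyperbolic space as the warped product \<open>\<real> \<times>\<^bsub>exp\<^esub> \<real>\<^sup>2\<close>\<close>

type_synonym hyp3 = "real \<times> (real^2)"

definition hyp3_metric :: "hyp3 riem" where
  "hyp3_metric p v w = fst v * fst w + exp (2 * fst p) * (snd v \<bullet> snd w)"

definition d_t :: hyp3 where
  "d_t = (1, 0)"

text \<open>A map of this form is automatically an immersion.\<close>

definition vertical_graph :: "(real^2 \<Rightarrow> hyp3) \<Rightarrow> bool" where
  "vertical_graph \<psi> \<longleftrightarrow>
     (\<exists>u. smooth u \<and> (\<forall>x. 0 \<le> u x) \<and> \<psi> = (\<lambda>x. (u x, x)))"

definition height :: "(real^2 \<Rightarrow> hyp3) \<Rightarrow> real^2 \<Rightarrow> real" where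
  "height \<psi> = fst \<circ> \<psi>"

text \<open>
  Unit speed and globally minimizing; in hyperbolic space every unit-speed geodesic ray minimizes.
\<close>

definition geodesic_ray :: "'a::real_normed_vector riem \<Rightarrow> (real \<Rightarrow> 'a) \<Rightarrow> bool" where
  "geodesic_ray g \<gamma> \<longleftrightarrow> (\<forall>s\<ge>0. \<forall>t\<ge>0. riem_dist g (\<gamma> s) (\<gamma> t) = \<bar>s - t\<bar>)"

text \<open>
  Horospheres are the level sets of Busemann functions \<open>p \<mapsto> lim (d(p, \<gamma>(s)) - s)\<close> of geodesic
  rays \<open>\<gamma>\<close>; the centre may be any ideal point, so not only the fibers \<open>{t\<^sub>0} \<times> \<real>\<^sup>2\<close> qualify.
\<close>

definition horosphere :: "hyp3 set \<Rightarrow> bool" where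
  "horosphere S \<longleftrightarrow>
     (\<exists>\<gamma> c. geodesic_ray hyp3_metric \<gamma> \<and>
            S = {p. ((\<lambda>s. riem_dist hyp3_metric p (\<gamma> s) - s) \<longlongrightarrow> c) at_top})"

end

theory Submission
  imports Defs
begin

text \<open>
  In the half-space model, with \<open>w = exp (- u)\<close>, the surface is the graph of the positive function
  \<open>w\<close> over the whole plane, \<open>|\<nabla>h|\<^sup>2 = 1 - 1/W\<^sup>2\<close> where \<open>W\<^sup>2 = 1 + |Dw|\<^sup>2\<close>, and
  \<open>w div (Dw / W) = 2 (H - 1/W)\<close>.  The gradient bound says \<open>H \<le> 1/W\<close>, so \<open>w\<close> is a positive
  supersolution of the minimal surface equation on the plane.  Such a function is constant:
  outside a small disc about \<open>y\<close> it dominates the strict subsolutions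
  \<open>m - \<epsilon> ln (1 + ln (|x - y|\<^sup>2 / r\<^sup>2))\<close>, which tend to \<open>- \<infinity>\<close> far away; letting \<open>\<epsilon> \<rightarrow> 0\<close> and then
  \<open>r \<rightarrow> 0\<close> gives \<open>w \<ge> w(y)\<close> everywhere.
\<close>

section \<open>Positive supersolutions of the minimal surface equation\<close>

text \<open>Since \<open>f'\<close> vanishes at the minimum, a negative \<open>l\<close> would make
  it negative just to the right of \<open>a\<close>, and \<open>f\<close> would drop below
  \<open>f a\<close> there.\<close>

lemma second_derivative_nonneg_at_local_min:
  fixes f f' :: "real \<Rightarrow> real"
  assumes "0 < d"
    and f: "\<And>s. \<bar>s - a\<bar> < d \<Longrightarrow> (f has_real_derivative f' s) (at s)"
    and f': "(f' has_real_derivative l) (at a)"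
    and min: "\<And>s. \<bar>s - a\<bar> < d \<Longrightarrow> f a \<le> f s"
  shows "f' a = 0" "0 \<le> l"
proof -
  show zero: "f' a = 0"
    using DERIV_local_min[of f "f' a" a d] f[of a] min \<open>0 < d\<close> by (simp add: abs_minus_commute)
  show "0 \<le> l"
  proof (rule ccontr)
    assume "\<not> 0 \<le> l"
    then obtain e where e: "e > 0" "\<And>h. 0 < h \<Longrightarrow> h < e \<Longrightarrow> f' (a + h) < f' a"
      using DERIV_neg_dec_right[OF f'] by force
    define b where "b = a + min d e / 2"
    have b: "a < b" "b < a + d" "b < a + e"
      using \<open>0 < d\<close> e(1) by (auto simp: b_def min_def field_simps)
    have "f b < f a"
    proof (rule DERIV_neg_imp_decreasing_open[OF b(1)])
      fix x assume "a < x" "x < b"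
      then show "\<exists>y. (f has_real_derivative y) (at x) \<and> y < 0"
        using e(2)[of "x - a"] f[of x] b zero by (intro exI[of _ "f' x"]) auto
    next
      show "continuous_on {a..b} f"
        by (rule DERIV_continuous_on[of _ _ f'])
          (use f b \<open>0 < d\<close> in \<open>auto intro: has_field_derivative_at_within\<close>)
    qed
    moreover have "f a \<le> f b"
      using min[of b] b by auto
    ultimately show False
      by simp
  qed
qed

lemma linear_real2:
  fixes L :: "real^2 \<Rightarrow> 'a::real_vector"
  assumes "linear L"
  shows "L v = v $ 1 *\<^sub>R L (axis 1 1) + v $ 2 *\<^sub>R L (axis 2 1)"
proof -
  have "L v = L (v $ 1 *\<^sub>R axis 1 1 + v $ 2 *\<^sub>R axis 2 1)"
    by (rule arg_cong[of _ _ L]) (simp add: vec_eq_iff forall_2 axis_def)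
  also have "\<dots> = v $ 1 *\<^sub>R L (axis 1 1) + v $ 2 *\<^sub>R L (axis 2 1)"
    by (simp only: linear_add[OF assms] linear_scale[OF assms])
  finally show ?thesis .
qed

text \<open>The hypothesis \<open>super\<close> is W^3 div(G/W) \<le> 0 with W^2 = 1 + |G|^2,
  expanded so that no division occurs.\<close>

lemma positive_minimal_supersolution_le:
  fixes w :: "real^2 \<Rightarrow> real" and G :: "real^2 \<Rightarrow> real^2"
  assumes pos: "\<And>x. 0 < w x"
    and w: "\<And>x. (w has_derivative (\<lambda>v. G x \<bullet> v)) (at x)"
    and G: "\<And>x. (G has_derivative D x) (at x)"
    and super: "\<And>x. (1 + G x \<bullet> G x) * (D x (axis 1 1) $ 1 + D x (axis 2 1) $ 2)
                    - G x \<bullet> D x (G x) \<le> 0"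
  shows "w y \<le> w x"
proof (rule ccontr)
  assume "\<not> w y \<le> w x"
  \<comment> \<open>The strict gap on both sides leaves a disc about \<open>y\<close> where
    \<open>w\<close> exceeds \<open>m\<close>, and room for a small perturbation at
    \<open>x\<close>.\<close>
  define m where "m = (w x + w y) / 2"
  have m: "w x < m" "m < w y"
    using \<open>\<not> w y \<le> w x\<close> by (auto simp: m_def)
  have cont: "continuous_on S w" for S
    by (rule has_derivative_continuous_on[OF has_derivative_at_withinI[OF w]])
  obtain r0 where r0: "0 < r0" "\<And>z. dist z y \<le> r0 \<Longrightarrow> m < w z"
  proof -
    have "eventually (\<lambda>z. m < w z) (nhds y)"
      using cont[of UNIV] m(2) by (metis continuous_on_eq_continuous_at open_UNIV UNIV_I
        isCont_def order_tendsto_iff tendsto_at_iff_tendsto_nhds)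
    then obtain d where "d > 0" "\<And>z. dist z y < d \<Longrightarrow> m < w z"
      by (auto simp: eventually_nhds_metric)
    then show ?thesis
      by (intro that[of "d / 2"]) auto
  qed
  define \<rho>0 where "\<rho>0 = r0\<^sup>2"
  have \<rho>0: "0 < \<rho>0"
    using r0(1) by (simp add: \<rho>0_def)
  \<comment> \<open>The barrier vanishes on the circle of radius \<open>r0\<close> and grows without
    bound. A single logarithm would be harmonic; the outer one makes it strictly superharmonic,
    which yields the strict inequality at the end.\<close>
  define f where "f z = ln (1 + ln ((z - y) \<bullet> (z - y) / \<rho>0))" for z
  have out: "r0 < dist x y"
    using r0(2)[of x] m by force
  \<comment> \<open>The second demand puts the perturbed function \<open>h\<close> below
    \<open>m\<close> at \<open>x\<close>; the third keeps the quadratic gradient term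
    \<open>k\<close> below the gain \<open>2 * g\<close> from the outer logarithm.\<close>
  obtain \<epsilon> where \<epsilon>: "0 < \<epsilon>" "\<epsilon> * f x < m - w x" "2 * \<epsilon>\<^sup>2 < \<rho>0"
  proof -
    have "((\<lambda>e. e * f x) \<longlongrightarrow> 0 * f x) (at_right 0)" "((\<lambda>e::real. 2 * e\<^sup>2) \<longlongrightarrow> 2 * 0\<^sup>2) (at_right 0)"
      by (intro tendsto_intros)+
    then have "eventually (\<lambda>e. e * f x < m - w x) (at_right 0)"
      "eventually (\<lambda>e::real. 2 * e\<^sup>2 < \<rho>0) (at_right 0)"
      using m \<rho>0 by (auto intro: order_tendstoD)
    moreover have "eventually (\<lambda>e::real. 0 < e) (at_right 0)"
      by (simp add: eventually_at_right_less)
    ultimately have "eventually (\<lambda>e. 0 < e \<and> e * f x < m - w x \<and> 2 * e\<^sup>2 < \<rho>0) (at_right 0)"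
      by eventually_elim auto
    then show ?thesis
      using that eventually_happens'[OF trivial_limit_at_right_real] by blast
  qed
  define h where "h z = w z + \<epsilon> * f z" for z
  \<comment> \<open>From the second radius on, \<open>\<epsilon> * f\<close> is at least
    \<open>m\<close>, so positivity of \<open>w\<close> lifts \<open>h\<close> above
    \<open>m\<close>; the maximum keeps \<open>x\<close> in the annulus \<open>A\<close>.\<close>
  define r1 where "r1 = max (dist x y) (sqrt (\<rho>0 * exp (exp (m / \<epsilon>))))"
  define A where "A = cball y r1 - ball y r0"
  have ge1: "1 \<le> (z - y) \<bullet> (z - y) / \<rho>0" if "r0 \<le> dist z y" for z
    using that r0(1) by (simp add: \<rho>0_def dist_norm power2_norm_eq_inner[symmetric] power_mono)
  have far: "m < h z" if "r1 \<le> dist z y" for z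
  proof -
    have "sqrt (\<rho>0 * exp (exp (m / \<epsilon>))) \<le> dist z y"
      using that by (simp add: r1_def)
    then have "\<rho>0 * exp (exp (m / \<epsilon>)) \<le> (dist z y)\<^sup>2"
      by (rule sqrt_le_D)
    then have "exp (exp (m / \<epsilon>)) \<le> (z - y) \<bullet> (z - y) / \<rho>0"
      using \<rho>0 by (simp add: dist_norm power2_norm_eq_inner field_simps)
    then have "exp (m / \<epsilon>) \<le> ln ((z - y) \<bullet> (z - y) / \<rho>0)"
      by (smt (verit, best) exp_gt_zero ln_exp ln_mono)
    then have "m / \<epsilon> \<le> f z"
      unfolding f_def by (smt (verit, best) exp_gt_zero ln_exp ln_mono)
    then show ?thesis
      using \<epsilon>(1) pos[of z] by (simp add: h_def field_simps)
  qed
  have near: "m < h z" if "dist z y = r0" for z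
  proof -
    have "f z = 0"
      using that r0(1) by (simp add: f_def \<rho>0_def dist_norm power2_norm_eq_inner[symmetric])
    then show ?thesis
      using r0(2)[of z] that by (simp add: h_def)
  qed
  have "x \<in> A"
    using out by (auto simp: A_def r1_def dist_commute)
  have "compact A"
    unfolding A_def by (intro compact_diff) auto
  moreover have "continuous_on A h"
  proof -
    have "1 + ln ((z - y) \<bullet> (z - y) / \<rho>0) \<noteq> 0" "(z - y) \<bullet> (z - y) / \<rho>0 \<noteq> 0" if "z \<in> A" for z
    proof -
      have "1 \<le> (z - y) \<bullet> (z - y) / \<rho>0"
        using ge1[of z] that by (simp add: A_def dist_commute)
      then show "1 + ln ((z - y) \<bullet> (z - y) / \<rho>0) \<noteq> 0" "(z - y) \<bullet> (z - y) / \<rho>0 \<noteq> 0"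
        using ln_ge_zero[of "(z - y) \<bullet> (z - y) / \<rho>0"] by linarith+
    qed
    then show ?thesis
      unfolding h_def f_def using \<rho>0 by (intro continuous_intros cont) auto
  qed
  ultimately obtain p where p: "p \<in> A" "\<And>z. z \<in> A \<Longrightarrow> h p \<le> h z"
    using continuous_attains_inf[of A h] \<open>x \<in> A\<close> by auto
  \<comment> \<open>Both boundary circles carry values above \<open>m\<close>, so the minimum point
    lies in the open annulus.\<close>
  have "h p < m"
    using p(2)[OF \<open>x \<in> A\<close>] \<epsilon> by (simp add: h_def)
  then have inner: "r0 < dist p y" "dist p y < r1"
    using near[of p] far[of p] p(1) by (force simp: A_def dist_commute)+
  have "open (ball y r1 - cball y r0)"
    by (intro open_Diff) auto
  then obtain e where e: "e > 0" "ball p e \<subseteq> ball y r1 - cball y r0"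
    using inner by (metis Diff_iff dist_commute mem_ball mem_cball not_less open_contains_ball)
  define z where "z = p - y"
  define \<rho> where "\<rho> = z \<bullet> z"
  define g where "g = 1 / (1 + ln (\<rho> / \<rho>0))"
  have \<rho>: "\<rho>0 < \<rho>"
    using inner r0(1) by (simp add: \<rho>_def \<rho>0_def z_def dist_norm power2_norm_eq_inner[symmetric] power_strict_mono)
  have g: "0 < g" "g < 1"
    using \<rho> \<rho>0 by (auto simp: g_def add_pos_pos)
  \<comment> \<open>First and second order conditions for the minimum of \<open>h\<close> along the
    line through \<open>p\<close> in direction \<open>v\<close>; the terms with
    \<open>\<epsilon>\<close> are the derivatives of the barrier.\<close>
  have test: "G p \<bullet> v + 2 * \<epsilon> * g * (z \<bullet> v) / \<rho> = 0"
    "0 \<le> D p v \<bullet> v + 2 * \<epsilon> * ((v \<bullet> v) * g / \<rho> - 2 * (z \<bullet> v)\<^sup>2 * (g + g\<^sup>2) / \<rho>\<^sup>2)" for v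
  proof -
    define d where "d = e / (1 + norm v)"
    have "d > 0"
      using e by (simp add: d_def add_pos_nonneg)
    define R where "R s = (z + s *\<^sub>R v) \<bullet> (z + s *\<^sub>R v)" for s
    define gs where "gs s = 1 / (1 + ln (R s / \<rho>0))" for s
    define h1 where "h1 s = G (p + s *\<^sub>R v) \<bullet> v
      + 2 * \<epsilon> * gs s * ((z + s *\<^sub>R v) \<bullet> v) / R s" for s
    have R: "(R has_real_derivative 2 * ((z + s *\<^sub>R v) \<bullet> v)) (at s)" for s
      unfolding R_def has_field_derivative_def
      by (auto intro!: derivative_eq_intros simp: fun_eq_iff algebra_simps inner_commute)
    have inA: "p + s *\<^sub>R v \<in> A" "r0 < dist (p + s *\<^sub>R v) y" if "\<bar>s - 0\<bar> < d" for s
    proof -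
      have "\<bar>s\<bar> * (1 + norm v) < e"
        using that by (simp add: d_def pos_less_divide_eq add_pos_nonneg)
      then have "\<bar>s\<bar> * norm v < e"
        by (simp add: algebra_simps)
      then have "p + s *\<^sub>R v \<in> ball p e"
        by (simp add: dist_norm)
      then have "p + s *\<^sub>R v \<in> ball y r1 - cball y r0"
        using e by blast
      then show "p + s *\<^sub>R v \<in> A" "r0 < dist (p + s *\<^sub>R v) y"
        by (auto simp: A_def dist_commute)
    qed
    have Rpos: "\<rho>0 < R s" "0 < 1 + ln (R s / \<rho>0)" if "\<bar>s - 0\<bar> < d" for s
    proof -
      have "r0\<^sup>2 < (dist (p + s *\<^sub>R v) y)\<^sup>2"
        using inA(2)[OF that] r0(1) by (intro power_strict_mono) auto
      then show "\<rho>0 < R s"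
        by (simp add: \<rho>0_def R_def z_def dist_norm power2_norm_eq_inner algebra_simps)
      then show "0 < 1 + ln (R s / \<rho>0)"
        using \<rho>0 by (intro add_pos_nonneg ln_ge_zero) auto
    qed
    have line: "((\<lambda>s. w (p + s *\<^sub>R v)) has_real_derivative G (p + s *\<^sub>R v) \<bullet> v) (at s)"
      "((\<lambda>s. G (p + s *\<^sub>R v) \<bullet> v) has_real_derivative D (p + s *\<^sub>R v) v \<bullet> v) (at s)" for s
    proof -
      have l: "((\<lambda>s. p + s *\<^sub>R v) has_derivative (\<lambda>t. t *\<^sub>R v)) (at s)"
        by (auto intro!: derivative_eq_intros)
      have "linear (D (p + s *\<^sub>R v))"
        using G has_derivative_linear by blast
      then show "((\<lambda>s. w (p + s *\<^sub>R v)) has_real_derivative G (p + s *\<^sub>R v) \<bullet> v) (at s)"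
        "((\<lambda>s. G (p + s *\<^sub>R v) \<bullet> v) has_real_derivative D (p + s *\<^sub>R v) v \<bullet> v) (at s)"
        using has_derivative_compose[OF l w] has_derivative_inner_left[OF has_derivative_compose[OF l G], of v]
        by (simp_all add: has_field_derivative_def linear_scale mult.commute[of _ "_ \<bullet> _"])
    qed
    have d1: "((\<lambda>s. h (p + s *\<^sub>R v)) has_real_derivative h1 s) (at s)" if "\<bar>s - 0\<bar> < d" for s
    proof -
      have eq: "h (p + s *\<^sub>R v) = w (p + s *\<^sub>R v) + \<epsilon> * ln (1 + ln (R s / \<rho>0))" for s
        by (simp add: h_def f_def R_def z_def algebra_simps)
      show ?thesis
        unfolding eq h1_def gs_def using Rpos[OF that] \<rho>0
        by (auto intro!: derivative_eq_intros line R add_pos_nonneg simp: field_simps simp del: ln_divide_pos ln_div)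
    qed
    have d2: "(h1 has_real_derivative
        D p v \<bullet> v + 2 * \<epsilon> * ((v \<bullet> v) * g / \<rho> - 2 * (z \<bullet> v)\<^sup>2 * (g + g\<^sup>2) / \<rho>\<^sup>2)) (at 0)"
    proof -
      have R0: "R 0 = \<rho>"
        by (simp add: R_def \<rho>_def)
      have gs0: "gs 0 = g"
        by (simp add: gs_def R0 g_def)
      have dg: "(gs has_real_derivative - (g\<^sup>2) * (2 * (z \<bullet> v)) / \<rho>) (at 0)"
        unfolding gs_def using Rpos[of 0] \<open>d > 0\<close> \<rho>0 R[of 0]
        by (auto intro!: derivative_eq_intros simp: R0 g_def power2_eq_square divide_simps simp del: ln_divide_pos ln_div)
      have dz: "((\<lambda>s. (z + s *\<^sub>R v) \<bullet> v) has_real_derivative v \<bullet> v) (at 0)"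
        unfolding has_field_derivative_def
        by (auto intro!: derivative_eq_intros simp: fun_eq_iff)
      have "\<rho> > 0"
        using \<rho> \<rho>0 by simp
      have "(h1 has_real_derivative D (p + 0 *\<^sub>R v) v \<bullet> v +
          ((2 * \<epsilon> * (- (g\<^sup>2) * (2 * (z \<bullet> v)) / \<rho>) * ((z + 0 *\<^sub>R v) \<bullet> v)
             + (v \<bullet> v) * (2 * \<epsilon> * gs 0)) * R 0
            - 2 * \<epsilon> * gs 0 * ((z + 0 *\<^sub>R v) \<bullet> v) * (2 * ((z + 0 *\<^sub>R v) \<bullet> v))) / (R 0 * R 0)) (at 0)"
        unfolding h1_def using \<open>\<rho> > 0\<close> R0
        by (intro DERIV_add DERIV_divide DERIV_mult DERIV_cmult line dg dz R) simp
      then show ?thesis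
        by (rule DERIV_cong)
          (use \<open>\<rho> > 0\<close> in \<open>simp add: R0 gs0 power2_eq_square divide_simps\<close>,
           use \<open>\<rho> > 0\<close> in \<open>simp add: algebra_simps\<close>)
    qed
    have "h (p + 0 *\<^sub>R v) \<le> h (p + s *\<^sub>R v)" if "\<bar>s - 0\<bar> < d" for s
      using p(2) inA(1)[OF that] by simp
    note second_derivative_nonneg_at_local_min[OF \<open>d > 0\<close> d1 d2 this]
    then show "G p \<bullet> v + 2 * \<epsilon> * g * (z \<bullet> v) / \<rho> = 0"
      "0 \<le> D p v \<bullet> v + 2 * \<epsilon> * ((v \<bullet> v) * g / \<rho> - 2 * (z \<bullet> v)\<^sup>2 * (g + g\<^sup>2) / \<rho>\<^sup>2)"
      by (simp_all add: h1_def gs_def R_def \<rho>_def g_def)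
  qed
  show False
  proof -
    \<comment> \<open>\<open>G p\<close> will be radial with squared length \<open>k\<close>.
      \<open>J\<close> is \<open>z\<close> turned by a right angle, so the trace of
      \<open>D p\<close> is read off from two orthogonal directions of equal length, and
      \<open>G p \<bullet> D p (G p)\<close> sees only the radial one.\<close>
    define a where "a = 2 * \<epsilon> * g"
    define k where "k = a\<^sup>2 / \<rho>"
    define J :: "real^2" where "J = vector [- z $ 2, z $ 1]"
    have a: "0 < a"
      using g \<epsilon> by (simp add: a_def)
    have "\<rho> > 0"
      using \<rho> \<rho>0 by simp
    have Gp: "G p = (- a / \<rho>) *\<^sub>R z"
    proof (rule vector_eq_rdot[THEN iffD1], intro allI)
      fix v show "G p \<bullet> v = ((- a / \<rho>) *\<^sub>R z) \<bullet> v"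
        using test(1)[of v] by (simp add: a_def)
    qed
    have lin: "linear (D p)"
      using G has_derivative_linear by blast
    note D = linear_real2[OF lin]
    define T where "T = D p (axis 1 1) $ 1 + D p (axis 2 1) $ 2"
    have tr: "D p z \<bullet> z + D p J \<bullet> J = \<rho> * T"
      unfolding D[of z] D[of J] by (simp add: \<rho>_def T_def J_def inner_vec_def sum_2 algebra_simps)
    have orth: "z \<bullet> J = 0" "J \<bullet> J = \<rho>"
      by (simp_all add: J_def \<rho>_def inner_vec_def sum_2)
    \<comment> \<open>The extra \<open>2 * g\<close> comes from the outer logarithm; the tangential
      bound \<open>DJ\<close> has no such term because \<open>z\<close> and \<open>J\<close> are
      orthogonal.\<close>
    have Dz: "a * (1 + 2 * g) \<le> D p z \<bullet> z"
    proof -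
      have "2 * \<epsilon> * (\<rho> * g / \<rho> - 2 * \<rho>\<^sup>2 * (g + g\<^sup>2) / \<rho>\<^sup>2) = - (a * (1 + 2 * g))"
        using \<open>\<rho> > 0\<close> by (simp add: a_def power2_eq_square nonzero_eq_divide_eq) (simp add: algebra_simps)
      then show ?thesis
        using test(2)[of z] by (simp add: \<rho>_def[symmetric])
    qed
    have DJ: "- a \<le> D p J \<bullet> J"
      using test(2)[of J] \<open>\<rho> > 0\<close> by (simp add: orth a_def)
    have "(1 + k) * T - (k / \<rho>) * (D p z \<bullet> z) \<le> 0"
    proof -
      have "G p \<bullet> G p = k"
        using \<open>\<rho> > 0\<close> by (simp add: Gp k_def \<rho>_def[symmetric] power2_eq_square)
      moreover have "G p \<bullet> D p (G p) = (k / \<rho>) * (D p z \<bullet> z)"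
        by (simp add: Gp k_def linear_scale[OF lin] linear_neg[OF lin] power2_eq_square inner_commute)
      ultimately show ?thesis
        using super[of p] by (simp add: T_def)
    qed
    then have "\<rho> * ((1 + k) * T - (k / \<rho>) * (D p z \<bullet> z)) \<le> 0"
      using \<open>\<rho> > 0\<close> by (simp add: mult_le_0_iff)
    then have "(1 + k) * (D p z \<bullet> z + D p J \<bullet> J) - k * (D p z \<bullet> z) \<le> 0"
      unfolding tr using \<open>\<rho> > 0\<close> by (simp add: algebra_simps)
    then have "D p z \<bullet> z + (1 + k) * (D p J \<bullet> J) \<le> 0"
      by (simp add: algebra_simps)
    moreover have "(1 + k) * (- a) \<le> (1 + k) * (D p J \<bullet> J)"
      using DJ \<open>\<rho> > 0\<close> by (intro mult_left_mono) (simp_all add: k_def)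
    \<comment> \<open>The harmonic parts \<open>a\<close> and \<open>- a\<close> of the two bounds
      cancel. What remains is the gain \<open>2 * g\<close> against the weight \<open>k\<close> on
      the tangential direction.\<close>
    ultimately have "a * (2 * g - k) \<le> 0"
      using Dz by (simp add: algebra_simps)
    moreover have "k < 2 * g"
    proof -
      have "k * \<rho> = 2 * g * (2 * \<epsilon>\<^sup>2 * g)"
        using \<open>\<rho> > 0\<close> by (simp add: k_def a_def power2_eq_square)
      also have "\<dots> < 2 * g * \<rho>"
      proof -
        have "2 * \<epsilon>\<^sup>2 * g \<le> 2 * \<epsilon>\<^sup>2"
          using g by (simp add: mult_left_le)
        then show ?thesis
          using g(1) \<epsilon>(3) \<rho> by (intro mult_strict_left_mono) linarith+
      qed
      finally show ?thesis
        using \<open>\<rho> > 0\<close> by simp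
    qed
    ultimately show False
      using a by (simp add: mult_le_0_iff)
  qed
qed

section \<open>Fibers are horospheres\<close>

text \<open>The speed dominates the derivative of the first coordinate in absolute value; integrate,
  using the fundamental theorem of calculus off the finitely many corners.\<close>

lemma hyp3_height_le_length:
  assumes "has_riem_length hyp3_metric \<gamma> L"
  shows "\<bar>fst (pathfinish \<gamma>) - fst (pathstart \<gamma>)\<bar> \<le> L"
proof -
  define F where "F = (\<lambda>s. fst (vector_derivative \<gamma> (at s)))"
  define G where "G = (\<lambda>s. sqrt (hyp3_metric (\<gamma> s) (vector_derivative \<gamma> (at s)) (vector_derivative \<gamma> (at s))))"
  have G: "(G has_integral L) {0..1}" and v: "valid_path \<gamma>"
    using assms by (auto simp: has_riem_length_def G_def)
  obtain K where K: "finite K" "\<And>s. s \<in> {0..1} - K \<Longrightarrow> \<gamma> differentiable (at s)"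
    and c: "continuous_on {0..1} \<gamma>"
    using v unfolding valid_path_def piecewise_C1_differentiable_on_def C1_differentiable_on_eq
    by (metis Diff_iff)
  have "(F has_integral (fst (\<gamma> 1) - fst (\<gamma> 0))) {0..1}"
  proof (rule fundamental_theorem_of_calculus_interior_strong[OF K(1)])
    fix s :: real assume "s \<in> {0<..<1} - K"
    then have "(\<gamma> has_vector_derivative vector_derivative \<gamma> (at s)) (at s)"
      using K(2)[of s] by (simp add: vector_derivative_works)
    then show "((\<lambda>s. fst (\<gamma> s)) has_vector_derivative F s) (at s)"
      unfolding F_def has_vector_derivative_def by (auto dest!: has_derivative_fst)
  qed (use c in \<open>auto intro: continuous_intros\<close>)
  moreover have "F s \<le> G s" "- F s \<le> G s" for s
    unfolding F_def G_def hyp3_metric_def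
    by (rule real_le_rsqrt, simp add: power2_eq_square)+
  ultimately have "fst (\<gamma> 1) - fst (\<gamma> 0) \<le> L" "- (fst (\<gamma> 1) - fst (\<gamma> 0)) \<le> L"
    using has_integral_le[OF _ G] has_integral_neg by blast+
  then show ?thesis
    by (auto simp: pathfinish_def pathstart_def)
qed

text \<open>Coordinate segments are not geodesics in general, but their explicit length supplies the
  upper bounds on the distance and shows that the set in \<open>riem_dist\<close> is
  nonempty.\<close>

lemma hyp3_linepath_length:
  obtains L where "has_riem_length hyp3_metric (linepath p q) L"
    "L = integral {0..1} (\<lambda>s. sqrt ((fst q - fst p)\<^sup>2 +
           exp (2 * (fst p + s * (fst q - fst p))) * (norm (snd q - snd p))\<^sup>2))"
proof -
  let ?f = "\<lambda>s. sqrt ((fst q - fst p)\<^sup>2 +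
           exp (2 * (fst p + s * (fst q - fst p))) * (norm (snd q - snd p))\<^sup>2)"
  have "sqrt (hyp3_metric (linepath p q s) (vector_derivative (linepath p q) (at s))
       (vector_derivative (linepath p q) (at s))) = ?f s" for s
  proof -
    have "2 * fst (linepath p q s) = 2 * (fst p + s * (fst q - fst p))"
      by (simp add: linepath_def algebra_simps)
    then show ?thesis
      by (simp only: vector_derivative_linepath_at hyp3_metric_def power2_norm_eq_inner
          fst_diff snd_diff power2_eq_square[of "fst q - fst p"])
  qed
  moreover have "(?f has_integral integral {0..1} ?f) {0..1}"
    by (intro integrable_integral integrable_continuous_interval continuous_intros)
  ultimately show ?thesis
    by (intro that[OF _ refl]) (simp add: has_riem_length_def)
qed

lemma hyp3_dist_ge: "\<bar>fst p - fst q\<bar> \<le> riem_dist hyp3_metric p q"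
proof -
  obtain L where "has_riem_length hyp3_metric (linepath p q) L"
    using hyp3_linepath_length[of p q] by blast
  then have "{L. \<exists>\<gamma>. pathstart \<gamma> = p \<and> pathfinish \<gamma> = q \<and> has_riem_length hyp3_metric \<gamma> L} \<noteq> {}"
    by (metis (mono_tags, lifting) empty_iff mem_Collect_eq pathfinish_linepath pathstart_linepath)
  then show ?thesis
    unfolding riem_dist_def
    by (rule cInf_greatest) (auto dest: hyp3_height_le_length)
qed

lemma hyp3_dist_le_length:
  assumes "has_riem_length hyp3_metric \<gamma> L"
  shows "riem_dist hyp3_metric (pathstart \<gamma>) (pathfinish \<gamma>) \<le> L"
  unfolding riem_dist_def using assms
  by (intro cInf_lower) (auto intro!: bdd_belowI[of _ 0] dest: hyp3_height_le_length
     intro: order_trans[OF abs_ge_zero])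

lemma hyp3_dist_vertical: "riem_dist hyp3_metric (s, x) (t, x) = \<bar>s - t\<bar>"
proof -
  obtain L where "has_riem_length hyp3_metric (linepath (s, x) (t, x)) L" "L = \<bar>s - t\<bar>"
    using hyp3_linepath_length[of "(s, x)" "(t, x)"] by (auto simp: abs_minus_commute)
  then show ?thesis
    using hyp3_dist_le_length[of "linepath (s, x) (t, x)" L] hyp3_dist_ge[of "(s, x)" "(t, x)"] by auto
qed

text \<open>
  The straight segment suffices: on a long vertical descent the horizontal displacement is spread
  over heights where the fibers are exponentially small, so its cost tends to \<open>0\<close>.
\<close>

lemma hyp3_dist_le:
  assumes "fst q < fst p"
  shows "riem_dist hyp3_metric p q
    \<le> (fst p - fst q) + exp (fst p) * norm (snd q - snd p) / (fst p - fst q)"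
proof -
  define a where "a = fst p - fst q"
  define b where "b = norm (snd q - snd p)"
  have a: "a > 0" and b: "b \<ge> 0" using assms by (auto simp: a_def b_def)
  let ?f = "\<lambda>s. sqrt (a\<^sup>2 + exp (2 * (fst p - s * a)) * b\<^sup>2)"
  obtain L where L: "has_riem_length hyp3_metric (linepath p q) L" "L = integral {0..1} ?f"
    using hyp3_linepath_length[of p q] by (auto simp: a_def b_def power2_commute algebra_simps)
  \<comment> \<open>The bound sqrt(a^2 + c^2) \<le> a + c replaces the speed by a majorant with an
    elementary primitive.\<close>
  have prim: "((\<lambda>s. a + exp (fst p - s * a) * b) has_integral
      (a * 1 - exp (fst p - 1 * a) * b / a) - (a * 0 - exp (fst p - 0 * a) * b / a)) {0..1}"
    using a by (intro fundamental_theorem_of_calculus)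
      (auto intro!: derivative_eq_intros simp: has_real_derivative_iff_has_vector_derivative[symmetric] field_simps)
  have "(?f has_integral L) {0..1}"
    unfolding L(2)
    by (intro integrable_integral integrable_continuous_interval continuous_intros)
  moreover have "?f s \<le> a + exp (fst p - s * a) * b" for s
    using a b by (intro real_le_lsqrt)
      (auto simp: power2_eq_square algebra_simps exp_add[symmetric])
  ultimately have "L \<le> a - exp (fst p - a) * b / a + exp (fst p) * b / a"
    using has_integral_le[OF _ prim] by simp
  also have "\<dots> \<le> a + exp (fst p) * b / a"
    using a b by simp
  finally show ?thesis
    using hyp3_dist_le_length[OF L(1)] by (simp add: a_def b_def)
qed

text \<open>The height is itself the Busemann function of a descending vertical ray:
  \<open>hyp3_dist_ge\<close> bounds from below, and \<open>hyp3_dist_le\<close> from above with an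
  error of order 1/s.\<close>

lemma horosphere_fiber: "horosphere (range (\<lambda>x. (t, x)))"
proof -
  \<comment> \<open>The ray descends because the fibers contract as the height decreases.\<close>
  define \<gamma> :: "real \<Rightarrow> hyp3" where "\<gamma> s = (- s, 0)" for s
  have ray: "geodesic_ray hyp3_metric \<gamma>"
    by (auto simp: geodesic_ray_def \<gamma>_def hyp3_dist_vertical)
  have lim: "((\<lambda>s. riem_dist hyp3_metric p (\<gamma> s) - s) \<longlongrightarrow> fst p) at_top" for p
  proof (rule tendsto_sandwich)
    show "eventually (\<lambda>s. fst p \<le> riem_dist hyp3_metric p (\<gamma> s) - s) at_top"
    proof (intro always_eventually allI)
      fix s show "fst p \<le> riem_dist hyp3_metric p (\<gamma> s) - s"
        using hyp3_dist_ge[of p "\<gamma> s"] by (simp add: \<gamma>_def)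
    qed
    show "eventually (\<lambda>s. riem_dist hyp3_metric p (\<gamma> s) - s
        \<le> fst p + exp (fst p) * norm (snd p) / (fst p + s)) at_top"
      using eventually_gt_at_top[of "- fst p"]
    proof eventually_elim
      case (elim s)
      then show ?case
        using hyp3_dist_le[of "\<gamma> s" p] by (simp add: \<gamma>_def)
    qed
    have "((\<lambda>s. exp (fst p) * norm (snd p) / (fst p + s)) \<longlongrightarrow> 0) at_top"
      by (intro tendsto_divide_0[OF tendsto_const] filterlim_at_top_imp_at_infinity
          filterlim_tendsto_add_at_top[OF tendsto_const] filterlim_ident)
    from tendsto_add[OF tendsto_const this]
    show "((\<lambda>s. fst p + exp (fst p) * norm (snd p) / (fst p + s)) \<longlongrightarrow> fst p) at_top"
      by simp
  qed auto
  have "range (\<lambda>x. (t, x)) = {p. ((\<lambda>s. riem_dist hyp3_metric p (\<gamma> s) - s) \<longlongrightarrow> t) at_top}"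
  proof (intro set_eqI iffI)
    fix p :: hyp3 assume "p \<in> {p. ((\<lambda>s. riem_dist hyp3_metric p (\<gamma> s) - s) \<longlongrightarrow> t) at_top}"
    then have "fst p = t"
      using lim[of p] tendsto_unique[OF trivial_limit_at_top_linorder] by blast
    then show "p \<in> range (\<lambda>x. (t, x))"
      by (metis prod.collapse rangeI)
  qed (use lim in force)
  then show ?thesis
    unfolding horosphere_def using ray by blast
qed

section \<open>Curvature of vertical graphs\<close>

lemma has_derivative_hyp3_metric:
  "((\<lambda>q. hyp3_metric q w y) has_derivative
     (\<lambda>v. 2 * fst v * exp (2 * fst p) * (snd w \<bullet> snd y))) (at p)"
  unfolding hyp3_metric_def by (auto intro!: derivative_eq_intros)

lemma hyp3_metric_eqI:
  assumes "\<And>y. hyp3_metric p z y = hyp3_metric p z' y"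
  shows "z = z'"
proof (rule prod_eqI)
  show "fst z = fst z'"
    using assms[of "(1, 0)"] by (simp add: hyp3_metric_def)
  have "snd z \<bullet> v = snd z' \<bullet> v" for v
    using assms[of "(0, v)"] by (simp add: hyp3_metric_def)
  then show "snd z = snd z'"
    using vector_eq_rdot by blast
qed

text \<open>Only the factor e^(2t) of the metric varies, and it depends on the height alone; the
  Koszul formula then gives the warped product formulas with logarithmic derivative 1 of the warping
  function. Nondegeneracy gives uniqueness.\<close>

lemma christoffel_hyp3:
  "christoffel hyp3_metric p v w =
     (- exp (2 * fst p) * (snd v \<bullet> snd w), fst v *\<^sub>R snd w + fst w *\<^sub>R snd v)"
  unfolding christoffel_def frechet_derivative_at[OF has_derivative_hyp3_metric, symmetric]
proof (rule the_equality, goal_cases)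
  case 1
  then show ?case
    by (auto simp: hyp3_metric_def inner_simps algebra_simps)
next
  case (2 z)
  show ?case
  proof (rule hyp3_metric_eqI[of p])
    fix y
    show "hyp3_metric p z y =
      hyp3_metric p (- exp (2 * fst p) * (snd v \<bullet> snd w), fst v *\<^sub>R snd w + fst w *\<^sub>R snd v) y"
      using 2[rule_format, of y] by (simp add: hyp3_metric_def inner_simps algebra_simps)
  qed
qed

text \<open>
  Below \<open>P\<close> is the Euclidean gradient of \<open>u\<close> and \<open>f = 1/W\<close>, where \<open>W\<^sup>2 = 1 + exp (- 2 u) |P|\<^sup>2\<close>.
\<close>

lemma frechet_derivative_graph:
  assumes "(u has_derivative (\<lambda>v. P \<bullet> v)) (at x)"
  shows "frechet_derivative (\<lambda>x. (u x, x)) (at x) = (\<lambda>v. (P \<bullet> v, v))"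
  by (rule frechet_derivative_at[symmetric]) (auto intro!: derivative_eq_intros assms)

text \<open>Orthogonality makes the horizontal part of \<open>N x\<close> a multiple of
  \<open>P x\<close>, unit length determines the vertical part up to sign, and \<open>down\<close>
  selects the sign.\<close>

lemma graph_unit_normal:
  fixes u :: "real^2 \<Rightarrow> real" and P :: "real^2 \<Rightarrow> real^2"
  assumes u: "\<And>x. (u has_derivative (\<lambda>v. P x \<bullet> v)) (at x)"
    and N: "unit_normal_field hyp3_metric (\<lambda>x. (u x, x)) N"
    and down: "\<And>x. hyp3_metric (u x, x) (N x) d_t < 0"
  shows "N x = (- inverse (sqrt (1 + exp (- 2 * u x) * (P x \<bullet> P x))),
                (exp (- 2 * u x) * inverse (sqrt (1 + exp (- 2 * u x) * (P x \<bullet> P x)))) *\<^sub>R P x)"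
proof -
  define n m where "n = fst (N x)" and "m = snd (N x)"
  define e where "e = exp (2 * u x)"
  have e: "e > 0" "exp (- 2 * u x) = inverse e"
    by (simp_all add: e_def exp_minus)
  have unit: "n * n + e * (m \<bullet> m) = 1" and orth: "n * (P x \<bullet> v) + e * (m \<bullet> v) = 0" for v
    using N by (auto simp: unit_normal_field_def hyp3_metric_def frechet_derivative_graph[OF u] n_def m_def e_def)
  have "n < 0"
    using down[of x] by (simp add: hyp3_metric_def d_t_def n_def)
  have m: "m = (- n / e) *\<^sub>R P x"
  proof (rule vector_eq_rdot[THEN iffD1], intro allI)
    fix v show "m \<bullet> v = ((- n / e) *\<^sub>R P x) \<bullet> v"
      using orth[of v] e by (simp add: field_simps)
  qed
  have "n\<^sup>2 * (1 + inverse e * (P x \<bullet> P x)) = 1"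
    using unit e unfolding m by (simp add: field_simps power2_eq_square)
  moreover have q: "0 < 1 + inverse e * (P x \<bullet> P x)"
    using e by (simp add: add_pos_nonneg)
  ultimately have "(- n)\<^sup>2 = (inverse (sqrt (1 + inverse e * (P x \<bullet> P x))))\<^sup>2"
    by (simp add: power_inverse field_simps)
  then have "- n = inverse (sqrt (1 + inverse e * (P x \<bullet> P x)))"
    using \<open>n < 0\<close> q by (subst (asm) power2_eq_iff_nonneg) auto
  moreover have "N x = (n, (inverse e * - n) *\<^sub>R P x)"
    using m e(1) unfolding n_def m_def by (intro prod_eqI) (auto simp: field_simps)
  ultimately show ?thesis
    unfolding e(2) by simp
qed

text \<open>This is w div(Dw/W) = 2(H - 1/W) for w = exp(-u), rewritten in terms of
  \<open>u\<close>. It comes from differentiating the explicit normal and taking the trace of the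
  shape operator.\<close>

lemma graph_mean_curvature:
  fixes u :: "real^2 \<Rightarrow> real" and P :: "real^2 \<Rightarrow> real^2"
  assumes u: "\<And>x. (u has_derivative (\<lambda>v. P x \<bullet> v)) (at x)"
    and P: "\<And>x. (P has_derivative D x) (at x)"
    and N: "unit_normal_field hyp3_metric (\<lambda>x. (u x, x)) N"
    and down: "\<And>x. hyp3_metric (u x, x) (N x) d_t < 0"
    and \<sigma>: "\<sigma> = exp (- 2 * u x)"
    and f: "f = inverse (sqrt (1 + \<sigma> * (P x \<bullet> P x)))"
  shows "2 * mean_curvature hyp3_metric (\<lambda>x. (u x, x)) N x =
    2 * f - \<sigma> * f * (D x (axis 1 1) $ 1 + D x (axis 2 1) $ 2 - P x \<bullet> P x
              - f\<^sup>2 * \<sigma> * (P x \<bullet> D x (P x) - (P x \<bullet> P x)\<^sup>2))"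
proof -
  define f' where "f' v = - (f ^ 3) * \<sigma> * (P x \<bullet> D x v - (P x \<bullet> v) * (P x \<bullet> P x))" for v
  define q where "q = 1 + \<sigma> * (P x \<bullet> P x)"
  have \<sigma>pos: "\<sigma> > 0"
    by (simp add: \<sigma>)
  have q: "q > 0"
    using \<sigma>pos by (simp add: q_def add_pos_nonneg)
  have ff: "f * f * q = 1"
    using q by (simp add: f q_def[symmetric] field_simps)
  have df: "((\<lambda>x. inverse (sqrt (1 + exp (- 2 * u x) * (P x \<bullet> P x)))) has_derivative f') (at x)"
  proof -
    have 1: "((\<lambda>x. 1 + exp (- 2 * u x) * (P x \<bullet> P x)) has_derivative
        (\<lambda>v. 2 * \<sigma> * (P x \<bullet> D x v - (P x \<bullet> v) * (P x \<bullet> P x)))) (at x)"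
      by (auto intro!: derivative_eq_intros u P simp: \<sigma> fun_eq_iff inner_commute algebra_simps)
    have q': "1 + exp (- 2 * u x) * (P x \<bullet> P x) = q"
      by (simp add: q_def \<sigma>)
    have 2: "((\<lambda>s. inverse (sqrt s)) has_real_derivative - (f ^ 3) / 2) (at q)"
      using q by (auto intro!: derivative_eq_intros simp: f q_def[symmetric] field_simps power3_eq_cube)
    have "((\<lambda>x. inverse (sqrt (1 + exp (- 2 * u x) * (P x \<bullet> P x)))) has_derivative
        (\<lambda>v. - (f ^ 3) / 2 * (2 * \<sigma> * (P x \<bullet> D x v - (P x \<bullet> v) * (P x \<bullet> P x))))) (at x)"
      using has_derivative_compose[OF 1, of "\<lambda>s. inverse (sqrt s)"] 2
      unfolding has_field_derivative_def q' by blast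
    then show ?thesis
      by (rule has_derivative_eq_rhs) (simp add: f'_def fun_eq_iff)
  qed
  \<comment> \<open>The second component of the differential of the graph map is the identity, so
    the shape operator can only be minus the horizontal part of the derivative of
    \<open>N\<close>.\<close>
  define S where "S v = f *\<^sub>R v - \<sigma> *\<^sub>R (f *\<^sub>R D x v + f' v *\<^sub>R P x - ((P x \<bullet> v) * f) *\<^sub>R P x)" for v
  have dN: "(N has_derivative (\<lambda>v. (- f' v,
      \<sigma> *\<^sub>R (f *\<^sub>R D x v + f' v *\<^sub>R P x - (2 * (P x \<bullet> v) * f) *\<^sub>R P x)))) (at x)"
    unfolding graph_unit_normal[OF u N down, abs_def]
    by (rule derivative_eq_intros u P df refl)+
      (simp add: \<sigma> f fun_eq_iff algebra_simps)
  have Nx: "N x = (- f, (\<sigma> * f) *\<^sub>R P x)"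
    unfolding graph_unit_normal[OF u N down] f \<sigma> ..
  have cov: "cov_deriv_along hyp3_metric (\<lambda>x. (u x, x)) N x v = (- f' v - f * (P x \<bullet> v), - S v)" for v
  proof -
    have "exp (2 * u x) = inverse \<sigma>"
      by (simp add: \<sigma> exp_minus)
    then have "cov_deriv_along hyp3_metric (\<lambda>x. (u x, x)) N x v =
      (- f' v - inverse \<sigma> * (v \<bullet> ((\<sigma> * f) *\<^sub>R P x)),
       \<sigma> *\<^sub>R (f *\<^sub>R D x v + f' v *\<^sub>R P x - (2 * (P x \<bullet> v) * f) *\<^sub>R P x)
         + ((P x \<bullet> v) *\<^sub>R ((\<sigma> * f) *\<^sub>R P x) + (- f) *\<^sub>R v))"
      unfolding cov_deriv_along_def frechet_derivative_at[OF dN, symmetric] frechet_derivative_graph[OF u]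
        christoffel_hyp3 Nx by simp
    also have "\<dots> = (- f' v - f * (P x \<bullet> v), - S v)"
      using \<sigma>pos by (simp add: S_def vec_eq_iff inner_commute algebra_simps)
    finally show ?thesis .
  qed
  \<comment> \<open>The vertical component of the defining equation of the shape operator, which
    expresses that the derivative of \<open>N\<close> is tangent to the surface; it rests on
    \<open>ff\<close>.\<close>
  have PS: "P x \<bullet> S v = f' v + f * (P x \<bullet> v)" for v
  proof -
    have "f * \<sigma> * (P x \<bullet> D x v - (P x \<bullet> v) * (P x \<bullet> P x)) = - q * f' v"
      using ff by (simp add: f'_def power3_eq_cube) algebra
    then show ?thesis
      by (simp add: S_def inner_simps q_def algebra_simps)
  qed
  have shape: "shape_operator hyp3_metric (\<lambda>x. (u x, x)) N x = S"
    unfolding shape_operator_def cov frechet_derivative_graph[OF u]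
    by (rule ext, rule the_equality) (auto simp: PS)
  have lin: "linear (D x)"
    using P has_derivative_linear by blast
  have f'P: "f' (axis 1 1) * P x $ 1 + f' (axis 2 1) * P x $ 2
      = - (f ^ 3) * \<sigma> * (P x \<bullet> D x (P x) - (P x \<bullet> P x)\<^sup>2)"
    using linear_real2[OF lin, of "P x"]
    by (simp add: f'_def inner_vec_def sum_2 axis_def power2_eq_square algebra_simps)
  have "2 * mean_curvature hyp3_metric (\<lambda>x. (u x, x)) N x = S (axis 1 1) $ 1 + S (axis 2 1) $ 2"
    by (simp add: mean_curvature_def shape trace_def sum_2 matrix_def)
  also have "\<dots> = 2 * f - \<sigma> * (f * (D x (axis 1 1) $ 1 + D x (axis 2 1) $ 2)
      + (f' (axis 1 1) * P x $ 1 + f' (axis 2 1) * P x $ 2) - f * (P x \<bullet> P x))"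
    by (simp add: S_def inner_vec_def sum_2 axis_def algebra_simps)
  finally show ?thesis
    unfolding f'P by (simp add: power3_eq_cube power2_eq_square algebra_simps)
qed

text \<open>The induced metric is a multiple of the Euclidean one plus the square of the
  differential of \<open>u\<close>, so the gradient is a multiple of \<open>P x\<close>.\<close>

lemma graph_height_gradient_norm:
  fixes u :: "real^2 \<Rightarrow> real" and P :: "real^2 \<Rightarrow> real^2"
  assumes u: "\<And>x. (u has_derivative (\<lambda>v. P x \<bullet> v)) (at x)"
  defines "g \<equiv> pullback_metric hyp3_metric (\<lambda>x. (u x, x))"
  assumes G: "G = riem_gradient g (height (\<lambda>x. (u x, x))) x"
  shows "g x G G = 1 - inverse (1 + exp (- 2 * u x) * (P x \<bullet> P x))"
proof -
  define e where "e = exp (2 * u x)"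
  have e: "e > 0" "exp (- 2 * u x) = inverse e"
    by (simp_all add: e_def exp_minus)
  have g: "g x v w = (P x \<bullet> v) * (P x \<bullet> w) + e * (v \<bullet> w)" for v w
    by (simp add: g_def pullback_metric_def frechet_derivative_graph[OF u] hyp3_metric_def e_def)
  have "height (\<lambda>x. (u x, x)) = u"
    by (auto simp: height_def)
  then have dh: "frechet_derivative (height (\<lambda>x. (u x, x))) (at x) = (\<lambda>v. P x \<bullet> v)"
    using frechet_derivative_at[OF u] by metis
  define z where "z = (1 / (e + P x \<bullet> P x)) *\<^sub>R P x"
  have pos: "e + P x \<bullet> P x > 0"
    using e by (simp add: add_pos_nonneg)
  have z: "g x z v = P x \<bullet> v" for v
  proof -
    have "g x z v = (P x \<bullet> v) * (e + P x \<bullet> P x) / (e + P x \<bullet> P x)"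
      by (simp add: g z_def algebra_simps add_divide_distrib)
    then show ?thesis
      using pos by simp
  qed
  have "G = z"
    unfolding G riem_gradient_def dh
  proof (rule the_equality)
    show "\<forall>v. g x z v = P x \<bullet> v"
      by (simp add: z)
    fix y assume "\<forall>v. g x y v = P x \<bullet> v"
    then have "g x y (y - z) - g x z (y - z) = 0"
      by (simp add: z)
    then have "g x (y - z) (y - z) = 0"
      by (simp add: g algebra_simps inner_diff_left)
    then have "e * ((y - z) \<bullet> (y - z)) \<le> 0"
      using zero_le_square[of "P x \<bullet> (y - z)"] unfolding g by linarith
    then have "(y - z) \<bullet> (y - z) \<le> 0"
      using e(1) by (simp add: mult_le_0_iff)
    then show "y = z"
      by (metis eq_iff_diff_eq_0 inner_eq_zero_iff inner_ge_zero order_antisym)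
  qed
  then have "g x G G = P x \<bullet> z"
    by (simp add: z)
  also have "\<dots> = 1 - inverse (1 + exp (- 2 * u x) * (P x \<bullet> P x))"
    unfolding e(2) using pos e(1) by (simp add: z_def divide_simps)
  finally show ?thesis .
qed

section \<open>Constancy of the height function\<close>

lemma smooth_gradient:
  fixes u :: "real^2 \<Rightarrow> real"
  assumes "smooth u"
  obtains P D where "\<And>x. (u has_derivative (\<lambda>v. P x \<bullet> v)) (at x)"
    "\<And>x. (P has_derivative D x) (at x)"
proof -
  let ?du = "\<lambda>x. frechet_derivative u (at x)"
  \<comment> \<open>Order two: one derivative for \<open>u\<close> and one for each partial
    derivative, these being the components of \<open>P\<close>.\<close>
  have "C_k (Suc (Suc 0)) u"
    using assms by (simp only: smooth_def)
  then have u: "\<And>x. (u has_derivative ?du x) (at x)" and du: "\<And>v x. (\<lambda>x. ?du x v) differentiable (at x)"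
    by (simp_all add: frechet_derivative_works[symmetric])
  define P where "P x = ?du x (axis 1 1) *\<^sub>R axis 1 1 + ?du x (axis 2 1) *\<^sub>R (axis 2 1 :: real^2)" for x
  have "?du x v = P x \<bullet> v" for x v
    by (subst linear_real2[OF has_derivative_linear[OF u]])
      (simp add: P_def inner_simps inner_axis' algebra_simps)
  moreover have "P differentiable (at x)" for x
    unfolding P_def by (intro differentiable_add differentiable_scaleR du differentiable_const)
  ultimately show ?thesis
    using that[of P "\<lambda>x. frechet_derivative P (at x)"] u
    unfolding frechet_derivative_works by (metis (no_types, lifting) has_derivative_eq_rhs ext)
qed

theorem theorem5p2:
  fixes \<psi> N :: "real^2 \<Rightarrow> hyp3" and H :: real
  assumes "vertical_graph \<psi>"
    and "riem_complete (pullback_metric hyp3_metric \<psi>)"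
    and "unit_normal_field hyp3_metric \<psi> N"
    and "\<forall>x. hyp3_metric (\<psi> x) (N x) d_t < 0"
    and "\<forall>x. 0 \<le> gaussian_curvature (pullback_metric hyp3_metric \<psi>) x"
    and "\<forall>x. mean_curvature hyp3_metric \<psi> N x = H"
    and "sqrt 2 / 2 \<le> H" and "H \<le> 1"
    and "\<forall>x. let G = riem_gradient (pullback_metric hyp3_metric \<psi>) (height \<psi>) x
             in pullback_metric hyp3_metric \<psi> x G G \<le> 1 - H\<^sup>2"
  shows "horosphere (range \<psi>)"
proof -
  obtain u where "smooth u" and \<psi>: "\<psi> = (\<lambda>x. (u x, x))"
    using assms(1) by (auto simp: vertical_graph_def)
  then obtain P D where u: "\<And>x. (u has_derivative (\<lambda>v. P x \<bullet> v)) (at x)"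
    and P: "\<And>x. (P has_derivative D x) (at x)"
    using smooth_gradient by blast
  have N: "unit_normal_field hyp3_metric (\<lambda>x. (u x, x)) N"
    and down: "\<And>x. hyp3_metric (u x, x) (N x) d_t < 0"
    using assms(3,4) by (auto simp: \<psi>)
  \<comment> \<open>Substituting w = e^(-t) turns the metric into (dw^2 + |dx|^2) / w^2, the
    half-space model.\<close>
  define w where "w x = exp (- u x)" for x
  have w: "(w has_derivative (\<lambda>v. (- w x *\<^sub>R P x) \<bullet> v)) (at x)" for x
    unfolding w_def by (auto intro!: derivative_eq_intros u)
  have Dw: "((\<lambda>x. - w x *\<^sub>R P x) has_derivative
      (\<lambda>v. w x *\<^sub>R ((P x \<bullet> v) *\<^sub>R P x - D x v))) (at x)" for x
    by (auto intro!: derivative_eq_intros w P simp: algebra_simps)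
  \<comment> \<open>By the mean curvature formula the left side is a positive multiple of H -
    1/W.\<close>
  have super: "(1 + (- w x *\<^sub>R P x) \<bullet> (- w x *\<^sub>R P x)) *
      ((w x *\<^sub>R ((P x \<bullet> axis 1 1) *\<^sub>R P x - D x (axis 1 1))) $ 1
        + (w x *\<^sub>R ((P x \<bullet> axis 2 1) *\<^sub>R P x - D x (axis 2 1))) $ 2)
      - (- w x *\<^sub>R P x) \<bullet> (w x *\<^sub>R ((P x \<bullet> (- w x *\<^sub>R P x)) *\<^sub>R P x - D x (- w x *\<^sub>R P x))) \<le> 0"
    for x
  proof -
    define \<sigma> where "\<sigma> = exp (- 2 * u x)"
    define q where "q = 1 + \<sigma> * (P x \<bullet> P x)"
    define f where "f = inverse (sqrt q)"
    define T where "T = D x (axis 1 1) $ 1 + D x (axis 2 1) $ 2"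
    define B where "B = P x \<bullet> D x (P x) - (P x \<bullet> P x)\<^sup>2"
    have \<sigma>: "\<sigma> > 0" and w\<sigma>: "w x * w x = \<sigma>"
      by (simp_all add: \<sigma>_def w_def exp_add[symmetric])
    have q: "q > 0"
      using \<sigma> by (simp add: q_def add_pos_nonneg)
    have f: "f > 0" "f\<^sup>2 = inverse q"
      using q by (simp_all add: f_def power_inverse)
    \<comment> \<open>The squared gradient norm is 1 - f^2, so the bound reads H^2 \<le> f^2, and
      positivity of \<open>f\<close> gives \<open>H \<le> f\<close>.\<close>
    have "1 - inverse q \<le> 1 - H\<^sup>2"
      using assms(9)[rule_format, of x]
      by (simp only: \<psi> Let_def \<sigma>_def q_def graph_height_gradient_norm[OF u refl])
    then have "H \<le> f"
      using f by (auto intro: power2_le_imp_le[of H f])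
    moreover have "2 * H = 2 * f - \<sigma> * f * (T - P x \<bullet> P x - f\<^sup>2 * \<sigma> * B)"
      using graph_mean_curvature[OF u P N down \<sigma>_def f_def[unfolded q_def]] assms(6)
      by (simp add: \<psi> T_def B_def)
    ultimately have "0 \<le> \<sigma> * f * (T - P x \<bullet> P x - f\<^sup>2 * \<sigma> * B)"
      by linarith
    then have "0 \<le> T - P x \<bullet> P x - f\<^sup>2 * \<sigma> * B"
      using \<sigma> f(1) by (simp add: zero_le_mult_iff mult_le_0_iff)
    then have "0 \<le> q * (T - P x \<bullet> P x - f\<^sup>2 * \<sigma> * B)"
      using q by simp
    also have "\<dots> = q * (T - P x \<bullet> P x) - \<sigma> * B"
      using q by (simp add: f(2) algebra_simps)
    finally have ge: "0 \<le> w x * (q * (T - P x \<bullet> P x) - \<sigma> * B)"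
      by (simp add: w_def)
    have tr: "(w x *\<^sub>R ((P x \<bullet> axis 1 1) *\<^sub>R P x - D x (axis 1 1))) $ 1
        + (w x *\<^sub>R ((P x \<bullet> axis 2 1) *\<^sub>R P x - D x (axis 2 1))) $ 2 = w x * (P x \<bullet> P x - T)"
      by (simp add: T_def inner_vec_def sum_2 axis_def algebra_simps)
    have gg: "1 + (- w x *\<^sub>R P x) \<bullet> (- w x *\<^sub>R P x) = q"
      by (simp add: q_def w\<sigma>[symmetric])
    have gDg: "(- w x *\<^sub>R P x) \<bullet> (w x *\<^sub>R ((P x \<bullet> (- w x *\<^sub>R P x)) *\<^sub>R P x - D x (- w x *\<^sub>R P x)))
        = - (w x * (\<sigma> * B))"
      unfolding linear_scale[OF has_derivative_linear[OF P]]
      by (simp add: B_def w\<sigma>[symmetric] inner_diff_right power2_eq_square algebra_simps)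
    show ?thesis
      unfolding gg tr gDg using ge by (simp add: algebra_simps)
  qed
  \<comment> \<open>The comparison holds for either order of the two points.\<close>
  have "w x = w y" for x y
    using positive_minimal_supersolution_le[OF _ w Dw super] by (intro antisym) (auto simp: w_def)
  then have "u x = u 0" for x
    by (simp add: w_def)
  then have "range \<psi> = range (\<lambda>x. (u 0, x))"
    unfolding \<psi> by metis
  then show ?thesis
    using horosphere_fiber by simp
qed

end
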